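(* The invariant complex subalgebras $\mathrm{II}$ and $\mathrm{III}$ of $\mathfrak{sl}(3,\mathbb C)$ are equivalent; that is, there is a Lie algebra automorphism $\varphi$ of $\mathfrak{sl}(3,\mathbb C)$ with $\sigma\varphi=\varphi\sigma$ and $\varphi(\mathrm{II})=\mathrm{III}$.
   Context: Let $\sigma$ be entrywise complex conjugation on $\mathfrak{sl}(3,\mathbb C)$, the conjugation with respect to the real form $\mathfrak{sl}(3,\mathbb R)$. An invariant complex subalgebra is a complex Lie subalgebra $\mathfrak m$ of $\mathfrak{sl}(3,\mathbb C)$ with $\mathfrak{sl}(3,\mathbb C)=\mathfrak m\oplus\sigma(\mathfrak m)$. Two invariant complex subalgebras $\mathfrak m_1,\mathfrak m_2$ are equivalent if there is a Lie algebra automorphism $\varphi$ of $\mathfrak{sl}(3,\mathbb C)$ with $\sigma\varphi=\varphi\sigma$ and $\varphi(\mathfrak m_1)=\mathfrak m_2$. The subalgebra $\mathrm{II}$ is the complex span of $$\tfrac12\begin{bmatrix}-1&-3i&0\\3i&-1&0\\0&0&2\end{bmatrix},\quad \tfrac1{\sqrt2}\begin{bmatrix}0&0&1\\0&0&i\\1&-i&0\end{bmatrix},\quad \tfrac1{\sqrt2}\begin{bmatrix}0&0&0\\0&0&0\\1&i&0\end{bmatrix},\quad \tfrac12\begin{bmatrix}1&i&0\\i&-1&0\\0&0&0\end{bmatrix}.$$ To describe $\mathrm{III}$, let $Q$ be the unitary $3\times3$ matrix with columns $\tfrac1{\sqrt2}(1,i,0)^t$, $(0,0,1)^t$, $\tfrac1{\sqrt2}(1,-i,0)^t$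 in this order, let $E_{jk}$ be the elementary matrices, and set $H_\alpha=Q(E_{11}-E_{22})Q^{-1}$, $H_\beta=Q(E_{22}-E_{33})Q^{-1}$, $e_\alpha=QE_{12}Q^{-1}$, $e_{-\alpha}=QE_{21}Q^{-1}$, $e_\beta=QE_{23}Q^{-1}$, $e_\gamma=QE_{13}Q^{-1}$. Then $\mathrm{III}$ is the complex span of $U=\tfrac12H_\alpha+H_\beta-\tfrac32(e_\alpha+e_{-\alpha}-e_\beta+e_\gamma)$, $X=\tfrac12H_\alpha+H_\beta+\tfrac12(e_\alpha+e_{-\alpha}+e_\beta-e_\gamma)$, $Y=-\tfrac12(H_\alpha+e_\alpha-e_{-\alpha}-e_\beta+e_\gamma)$, $Z=\tfrac12(H_\alpha+e_\alpha-e_{-\alpha}+e_\beta-e_\gamma)$. *)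

theory Defs
  imports "HOL-Analysis.Analysis"
begin

type_synonym cmat3 = "complex^3^3"

(* The library provides only the real scaling of complex matrices; Lie subalgebras and
   spans below are over the complex numbers, with respect to this scaling. *)
definition cscale :: "complex \<Rightarrow> cmat3 \<Rightarrow> cmat3"  (infixr \<open>*\<^sub>M\<close> 75)
  where "c *\<^sub>M A = map_matrix ((*) c) A"

global_interpretation cmat: vector_space cscale
  by unfold_locales (simp_all add: cscale_def vec_eq_iff algebra_simps)

definition bracket :: "cmat3 \<Rightarrow> cmat3 \<Rightarrow> cmat3"
  where "bracket A B = A ** B - B ** A"

definition sl3 :: "cmat3 set"
  where "sl3 = {A. trace A = 0}"

definition sigma_conj :: "cmat3 \<Rightarrow> cmat3"
  where "sigma_conj = map_matrix cnj"

definition lie_subalgebra :: "cmat3 set \<Rightarrow> bool"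
  where "lie_subalgebra M \<longleftrightarrow>
    M \<subseteq> sl3 \<and> cmat.subspace M \<and> (\<forall>A\<in>M. \<forall>B\<in>M. bracket A B \<in> M)"

definition invariant_complex_subalgebra :: "cmat3 set \<Rightarrow> bool"
  where "invariant_complex_subalgebra M \<longleftrightarrow>
    lie_subalgebra M \<and>
    sl3 = {A + B | A B. A \<in> M \<and> B \<in> sigma_conj ` M} \<and>
    M \<inter> sigma_conj ` M = {0}"

(* Automorphisms are complex linear; only the values of f on sl3 matter. *)
definition lie_automorphism :: "(cmat3 \<Rightarrow> cmat3) \<Rightarrow> bool"
  where "lie_automorphism f \<longleftrightarrow>
    bij_betw f sl3 sl3 \<and>
    (\<forall>A\<in>sl3. \<forall>B\<in>sl3. f (A + B) = f A + f B) \<and>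
    (\<forall>c. \<forall>A\<in>sl3. f (c *\<^sub>M A) = c *\<^sub>M f A) \<and>
    (\<forall>A\<in>sl3. \<forall>B\<in>sl3. f (bracket A B) = bracket (f A) (f B))"

definition equivalent_subalgebras :: "cmat3 set \<Rightarrow> cmat3 set \<Rightarrow> bool"
  where "equivalent_subalgebras M N \<longleftrightarrow>
    (\<exists>f. lie_automorphism f \<and>
         (\<forall>A\<in>sl3. sigma_conj (f A) = f (sigma_conj A)) \<and>
         f ` M = N)"

(* Inner vectors are rows. *)
definition subalg_II :: "cmat3 set"
  where "subalg_II = cmat.span
   {(1/2) *\<^sub>M vector [vector [-1, -3*\<i>, 0],
                    vector [3*\<i>, -1, 0],
                    vector [0, 0, 2]],
    (1 / complex_of_real (sqrt 2)) *\<^sub>M vector [vector [0, 0, 1],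
                                             vector [0, 0, \<i>],
                                             vector [1, -\<i>, 0]],
    (1 / complex_of_real (sqrt 2)) *\<^sub>M vector [vector [0, 0, 0],
                                             vector [0, 0, 0],
                                             vector [1, \<i>, 0]],
    (1/2) *\<^sub>M vector [vector [1, \<i>, 0],
                    vector [\<i>, -1, 0],
                    vector [0, 0, 0]]}"

(* The listed vectors are the columns of Q, hence the transpose. *)
definition Q_mat :: cmat3
  where "Q_mat = transpose (vector
    [(1 / complex_of_real (sqrt 2)) *s vector [1, \<i>, 0],
     vector [0, 0, 1],
     (1 / complex_of_real (sqrt 2)) *s vector [1, -\<i>, 0]])"

definition E_mat :: "3 \<Rightarrow> 3 \<Rightarrow> cmat3"
  where "E_mat j k = (\<chi> a b. if a = j \<and> b = k then 1 else 0)"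

definition Q_conj :: "cmat3 \<Rightarrow> cmat3"
  where "Q_conj A = Q_mat ** A ** matrix_inv Q_mat"

definition H_alpha :: cmat3 where "H_alpha = Q_conj (E_mat 1 1 - E_mat 2 2)"
definition H_beta :: cmat3 where "H_beta = Q_conj (E_mat 2 2 - E_mat 3 3)"
definition e_alpha :: cmat3 where "e_alpha = Q_conj (E_mat 1 2)"
definition e_minus_alpha :: cmat3 where "e_minus_alpha = Q_conj (E_mat 2 1)"
definition e_beta :: cmat3 where "e_beta = Q_conj (E_mat 2 3)"
definition e_gamma :: cmat3 where "e_gamma = Q_conj (E_mat 1 3)"

definition U_mat :: cmat3
  where "U_mat = (1/2) *\<^sub>M H_alpha + H_beta
                  - (3/2) *\<^sub>M (e_alpha + e_minus_alpha - e_beta + e_gamma)"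

definition X_mat :: cmat3
  where "X_mat = (1/2) *\<^sub>M H_alpha + H_beta
                  + (1/2) *\<^sub>M (e_alpha + e_minus_alpha + e_beta - e_gamma)"

definition Y_mat :: cmat3
  where "Y_mat = - ((1/2) *\<^sub>M (H_alpha + e_alpha - e_minus_alpha - e_beta + e_gamma))"

definition Z_mat :: cmat3
  where "Z_mat = (1/2) *\<^sub>M (H_alpha + e_alpha - e_minus_alpha + e_beta - e_gamma)"

definition subalg_III :: "cmat3 set"
  where "subalg_III = cmat.span {U_mat, X_mat, Y_mat, Z_mat}"

end

theory Submission
  imports Defs
begin

text \<open>
  In the basis of columns of \<open>Q\<close> the subalgebra II consists of the endomorphisms stabilising two lines
  and the plane they span, whereas III stabilises two planes and the line in which they meet. Hence
  only an outer automorphism can identify them. The one used here is \<open>A \<mapsto> - K A\<^sup>T K\<^sup>-\<^sup>1\<close> with the real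
  matrix \<open>K = Q G Q\<^sup>T\<close>, where \<open>G\<close> sends the standard basis to \<open>(0, -1, 1), (1, 0, 1), (1, -1, 0)\<close>. It is
  determined, up to scaling, by matching a complex point, its conjugate and two real points of the
  projective plane attached to the two flags, and it maps the four listed generators of II to
  \<open>U, X, Y, Z\<close>.
\<close>

section \<open>Entrywise and algebraic rules for matrices\<close>

lemma cscale_nth [simp]: "(c *\<^sub>M A) $ i $ j = c * A $ i $ j"
  by (simp add: cscale_def map_matrix_def)

lemma sigma_conj_nth [simp]: "sigma_conj A $ i $ j = cnj (A $ i $ j)"
  by (simp add: sigma_conj_def map_matrix_def)

lemma mat3_eq_iff:
  "(A :: 'a^3^3) = B \<longleftrightarrow>
     A $ 1 $ 1 = B $ 1 $ 1 \<and> A $ 1 $ 2 = B $ 1 $ 2 \<and> A $ 1 $ 3 = B $ 1 $ 3 \<and>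
     A $ 2 $ 1 = B $ 2 $ 1 \<and> A $ 2 $ 2 = B $ 2 $ 2 \<and> A $ 2 $ 3 = B $ 2 $ 3 \<and>
     A $ 3 $ 1 = B $ 3 $ 1 \<and> A $ 3 $ 2 = B $ 3 $ 2 \<and> A $ 3 $ 3 = B $ 3 $ 3"
  by (auto simp: vec_eq_iff forall_3)

lemma matrix_mult_nth3: "(A ** B) $ i $ j = A $ i $ 1 * B $ 1 $ j + A $ i $ 2 * B $ 2 $ j + A $ i $ 3 * B $ 3 $ j"
  for A B :: "'a::semiring_1^3^3"
  by (simp add: matrix_matrix_mult_def sum_3)

lemma trace3: "trace A = A $ 1 $ 1 + A $ 2 $ 2 + A $ 3 $ 3" for A :: "'a::semiring_1^3^3"
  by (simp add: trace_def sum_3)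

lemma cscale_minus: "c *\<^sub>M (- A) = - (c *\<^sub>M A)"
  by (simp add: vec_eq_iff)

lemma trace_minus: "trace (- A) = - trace A" for A :: cmat3
  by (simp add: trace3)

lemma trace_transpose: "trace (transpose A) = trace A"
  by (simp add: trace_def transpose_def)

lemma sigma_conj_simps:
  "sigma_conj (A + B) = sigma_conj A + sigma_conj B"
  "sigma_conj (- A) = - sigma_conj A"
  "sigma_conj (A ** B) = sigma_conj A ** sigma_conj B"
  "sigma_conj (transpose A) = transpose (sigma_conj A)"
  by (simp_all add: vec_eq_iff matrix_mult_nth3 transpose_def)

lemma cscale_simps:
  "(c *\<^sub>M A) ** B = c *\<^sub>M (A ** B)"
  "A ** (c *\<^sub>M B) = c *\<^sub>M (A ** B)"
  "transpose (c *\<^sub>M A) = c *\<^sub>M transpose A"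
  by (simp_all add: vec_eq_iff matrix_mult_nth3 transpose_def algebra_simps)

lemma matrix_mult_simps:
  "(- A) ** B = - (A ** B)" "A ** (- B) = - (A ** B)"
  "(A + B) ** C = A ** C + B ** C" "A ** (B + C) = A ** B + A ** C"
  "(A - B) ** C = A ** C - B ** C" "A ** (B - C) = A ** B - A ** C" for A B C :: cmat3
  by (simp_all add: vec_eq_iff matrix_mult_nth3 algebra_simps)

lemma transpose_minus: "transpose (- A) = - transpose A" for A :: "'a::group_add^'n^'m"
  by (simp add: vec_eq_iff transpose_def)

lemma transpose_add: "transpose (A + B) = transpose A + transpose B" for A B :: "'a::plus^'n^'m"
  by (simp add: vec_eq_iff transpose_def)

lemma transpose_diff: "transpose (A - B) = transpose A - transpose B" for A B :: "'a::minus^'n^'m"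
  by (simp add: vec_eq_iff transpose_def)

section \<open>Automorphisms built from the negative transpose\<close>

text \<open>\<open>L\<close> stands for the inverse of \<open>K\<close>. Passing it explicitly lets
  concrete images be computed entry by entry, without \<open>matrix_inv\<close>.\<close>

definition outer_aut :: "cmat3 \<Rightarrow> cmat3 \<Rightarrow> cmat3 \<Rightarrow> cmat3"
  where "outer_aut K L A = - (K ** transpose A ** L)"

lemma outer_aut_linear:
  "outer_aut K L (A + B) = outer_aut K L A + outer_aut K L B"
  "outer_aut K L (c *\<^sub>M A) = c *\<^sub>M outer_aut K L A"
  by (simp_all add: outer_aut_def transpose_add cscale_simps matrix_mult_simps cscale_minus)

text \<open>The two transpositions and the two signs cancel, leaving only factors
  \<open>K ** L\<close>. So the inverse has the same shape, with the transposed pair.\<close>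

lemma outer_aut_inverse:
  assumes "K ** L = mat 1"
  shows "outer_aut K L (outer_aut (transpose K) (transpose L) A) = A"
proof -
  have "outer_aut K L (outer_aut (transpose K) (transpose L) A) = (K ** L) ** A ** (K ** L)"
    by (simp add: outer_aut_def transpose_minus matrix_mult_simps matrix_transpose_mul matrix_mul_assoc)
  then show ?thesis
    using assms by simp
qed

lemma outer_aut_lie_automorphism:
  assumes KL: "K ** L = mat 1"
  shows "lie_automorphism (outer_aut K L)"
proof -
  have LK: "L ** K = mat 1"
    using KL matrix_left_right_inverse by blast
  \<comment> \<open>\<open>K\<close> and \<open>L\<close> are generalised afresh because the
    transposed pair, which gives the inverse map, needs this too.\<close>
  have sl3: "outer_aut K L A \<in> sl3" if "A \<in> sl3" "K ** L = mat 1" for K L A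
  proof -
    have "trace (K ** transpose A ** L) = trace (L ** (K ** transpose A))"
      by (rule trace_mul_sym)
    also have "\<dots> = trace (transpose A)"
      using that matrix_left_right_inverse[of K L] by (simp add: matrix_mul_assoc)
    finally show ?thesis
      using that by (simp add: sl3_def outer_aut_def trace_minus trace_transpose)
  qed
  have tKL: "transpose K ** transpose L = mat 1"
    by (metis LK matrix_transpose_mul transpose_mat)
  have "bij_betw (outer_aut K L) sl3 sl3"
  proof (rule bij_betwI[where g = "outer_aut (transpose K) (transpose L)"])
    show "outer_aut (transpose K) (transpose L) (outer_aut K L A) = A" for A
      using outer_aut_inverse[OF tKL, of A] by simp
  qed (use sl3 KL tKL outer_aut_inverse in auto)
  \<comment> \<open>Transposition reverses products and so negates brackets; the minus sign in
    \<open>outer_aut\<close> makes up for this.\<close>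
  moreover have "outer_aut K L (bracket A B) = bracket (outer_aut K L A) (outer_aut K L B)" for A B
  proof -
    have "outer_aut K L A ** outer_aut K L B = K ** transpose A ** (L ** K) ** transpose B ** L" for A B
      by (simp add: outer_aut_def matrix_mult_simps matrix_mul_assoc)
    then have "outer_aut K L A ** outer_aut K L B = K ** transpose (B ** A) ** L" for A B
      by (simp add: LK matrix_transpose_mul matrix_mul_assoc)
    then show ?thesis
      by (simp add: bracket_def) (simp add: outer_aut_def transpose_diff matrix_mult_simps)
  qed
  ultimately show ?thesis
    by (simp add: lie_automorphism_def outer_aut_linear)
qed

section \<open>Transport along automorphisms commuting with conjugation\<close>

lemma invariant_complex_subalgebra_image:
  assumes M: "invariant_complex_subalgebra M" and f: "lie_automorphism f"
    and comm: "\<And>A. A \<in> sl3 \<Longrightarrow> sigma_conj (f A) = f (sigma_conj A)"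
  shows "invariant_complex_subalgebra (f ` M)"
proof -
  have Ms: "M \<subseteq> sl3" and sub: "cmat.subspace M"
    and br: "\<And>A B. A \<in> M \<Longrightarrow> B \<in> M \<Longrightarrow> bracket A B \<in> M"
    and sum: "sl3 = {A + B | A B. A \<in> M \<and> B \<in> sigma_conj ` M}"
    and int: "M \<inter> sigma_conj ` M = {0}"
    using M by (auto simp: invariant_complex_subalgebra_def lie_subalgebra_def)
  have bij: "bij_betw f sl3 sl3"
    and add: "\<And>A B. A \<in> sl3 \<Longrightarrow> B \<in> sl3 \<Longrightarrow> f (A + B) = f A + f B"
    and scale: "\<And>c A. A \<in> sl3 \<Longrightarrow> f (c *\<^sub>M A) = c *\<^sub>M f A"
    and fbr: "\<And>A B. A \<in> sl3 \<Longrightarrow> B \<in> sl3 \<Longrightarrow> f (bracket A B) = bracket (f A) (f B)"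
    using f by (auto simp: lie_automorphism_def)
  have img: "f ` sl3 = sl3" and inj: "inj_on f sl3"
    using bij by (auto simp: bij_betw_def)
  have \<sigma>Ms: "sigma_conj ` M \<subseteq> sl3"
    using Ms by (fastforce simp: sl3_def trace3 simp flip: complex_cnj_add)
  have \<sigma>f: "sigma_conj ` f ` M = f ` sigma_conj ` M"
    using comm Ms by (force simp: image_iff)
  have f0: "f 0 = 0"
    using scale[of 0 0] by (simp add: sl3_def trace3)
  have "cmat.subspace (f ` M)"
    unfolding cmat.subspace_def
  proof (intro conjI ballI allI)
    show "0 \<in> f ` M"
      using f0 cmat.subspace_0[OF sub] by (metis imageI)
    show "A + B \<in> f ` M" if "A \<in> f ` M" "B \<in> f ` M" for A B
      using that add Ms cmat.subspace_add[OF sub] by (smt (verit) image_iff subsetD)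
    show "c *\<^sub>M A \<in> f ` M" if "A \<in> f ` M" for A c
      using that scale Ms cmat.subspace_scale[OF sub] by (smt (verit) image_iff subsetD)
  qed
  moreover have "bracket A B \<in> f ` M" if "A \<in> f ` M" "B \<in> f ` M" for A B
    using that fbr Ms br by (smt (verit) image_iff subsetD)
  moreover have "f ` M \<subseteq> sl3"
    using Ms img by blast
  moreover have "sl3 = {A + B | A B. A \<in> f ` M \<and> B \<in> f ` sigma_conj ` M}"
  proof -
    have "sl3 = f ` {A + B | A B. A \<in> M \<and> B \<in> sigma_conj ` M}"
      using img sum by simp
    also have "\<dots> = {f (A + B) | A B. A \<in> M \<and> B \<in> sigma_conj ` M}"
      by auto
    also have "\<dots> = {f A + f B | A B. A \<in> M \<and> B \<in> sigma_conj ` M}"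
      using add Ms \<sigma>Ms by (metis (no_types, opaque_lifting) subsetD)
    also have "\<dots> = {A + B | A B. A \<in> f ` M \<and> B \<in> f ` sigma_conj ` M}"
      by blast
    finally show ?thesis .
  qed
  \<comment> \<open>Injectivity on \<open>sl3\<close> makes the image of the intersection equal to
    the intersection of the images.\<close>
  moreover have "f ` M \<inter> f ` sigma_conj ` M = {0}"
    using inj_on_image_Int[OF inj Ms \<sigma>Ms] int f0 by simp
  ultimately show ?thesis
    by (simp add: invariant_complex_subalgebra_def lie_subalgebra_def \<sigma>f)
qed

section \<open>Coordinates on II and its invariance\<close>

abbreviation r2 :: complex where "r2 \<equiv> complex_of_real (sqrt 2)"

lemma r2_sq [simp]: "r2 * r2 = 2" "r2 * (r2 * z) = 2 * z"
proof -
  show "r2 * r2 = 2"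
    by (simp flip: of_real_mult)
  then show "r2 * (r2 * z) = 2 * z"
    by (simp flip: mult.assoc)
qed

lemma span_4: "cmat.span {A, B, C, D} = {a *\<^sub>M A + b *\<^sub>M B + c *\<^sub>M C + d *\<^sub>M D | a b c d. True}"
proof -
  have "X \<in> cmat.span {A, B, C, D} \<longleftrightarrow> (\<exists>a b c d. X = a *\<^sub>M A + b *\<^sub>M B + c *\<^sub>M C + d *\<^sub>M D)" for X
    unfolding cmat.span_insert cmat.span_empty
    by (simp add: diff_eq_eq add_ac)
  then show ?thesis
    by blast
qed

text \<open>In the basis of columns of \<open>Q\<close> this matrix has rows
  \<open>(a, b, d)\<close>, \<open>(b, a, c)\<close>, \<open>(0, 0, -2a)\<close>. The parameters are
  the coefficients of the four generators of II in the listed order.\<close>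

definition II_elt :: "complex \<Rightarrow> complex \<Rightarrow> complex \<Rightarrow> complex \<Rightarrow> cmat3"
  where "II_elt a b c d = vector
    [vector [(d - a) / 2, \<i> * (d - 3 * a) / 2, b / r2],
     vector [\<i> * (d + 3 * a) / 2, - (a + d) / 2, \<i> * b / r2],
     vector [(b + c) / r2, \<i> * (c - b) / r2, a]]"

lemma subalg_II_eq: "subalg_II = {II_elt a b c d | a b c d. True}"
proof -
  have "a *\<^sub>M (1/2) *\<^sub>M vector [vector [-1, -3*\<i>, 0], vector [3*\<i>, -1, 0], vector [0, 0, 2]]
    + b *\<^sub>M (1 / r2) *\<^sub>M vector [vector [0, 0, 1], vector [0, 0, \<i>], vector [1, -\<i>, 0]]
    + c *\<^sub>M (1 / r2) *\<^sub>M vector [vector [0, 0, 0], vector [0, 0, 0], vector [1, \<i>, 0]]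
    + d *\<^sub>M (1/2) *\<^sub>M vector [vector [1, \<i>, 0], vector [\<i>, -1, 0], vector [0, 0, 0]]
    = II_elt a b c d" for a b c d
    by (simp add: mat3_eq_iff II_elt_def field_simps)
  then show ?thesis
    unfolding subalg_II_def span_4 by simp
qed

text \<open>The elements with \<open>a = b = 0\<close> form an abelian ideal. Those with
  \<open>c = d = 0\<close> commute and act on it by \<open>3 * a\<close> on each coordinate and by
  \<open>b\<close> across the two.\<close>

lemma bracket_II_elt:
  "bracket (II_elt a b c d) (II_elt a' b' c' d') =
     II_elt 0 0 (3 * (a * c' - a' * c) + b * d' - b' * d) (3 * (a * d' - a' * d) + b * c' - b' * c)"
  by (simp add: mat3_eq_iff bracket_def matrix_mult_nth3 II_elt_def field_simps)

lemma invariant_II: "invariant_complex_subalgebra subalg_II"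
  unfolding invariant_complex_subalgebra_def lie_subalgebra_def
proof (intro conjI ballI)
  show sl3: "subalg_II \<subseteq> sl3"
    by (auto simp: subalg_II_eq sl3_def trace3 II_elt_def field_simps)
  show "cmat.subspace subalg_II"
    by (simp add: subalg_II_def)
  show "bracket A B \<in> subalg_II" if "A \<in> subalg_II" "B \<in> subalg_II" for A B
    using that bracket_II_elt by (fastforce simp: subalg_II_eq)
  have \<sigma>sl3: "sigma_conj ` subalg_II \<subseteq> sl3"
    using sl3 by (fastforce simp: sl3_def trace3 simp flip: complex_cnj_add)
  show "sl3 = {A + B | A B. A \<in> subalg_II \<and> B \<in> sigma_conj ` subalg_II}" (is "_ = ?S")
  proof
    show "?S \<subseteq> sl3"
      using sl3 \<sigma>sl3 by (fastforce simp: sl3_def trace_add)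
    show "sl3 \<subseteq> ?S"
    proof
      fix M :: cmat3
      assume "M \<in> sl3"
      then have M33: "M $ 3 $ 3 = - M $ 1 $ 1 - M $ 2 $ 2"
        by (simp add: sl3_def trace3 eq_neg_iff_add_eq_0 algebra_simps)
      \<comment> \<open>\<open>m j k\<close> is the matrix of \<open>M\<close> in the basis of columns of \<open>Q\<close>.\<close>
      define m11 m22 m33 m12 m21 m13 m31 m23 m32 where m:
        "m11 = (M $ 1 $ 1 + \<i> * M $ 1 $ 2 - \<i> * M $ 2 $ 1 + M $ 2 $ 2) / 2"
        "m22 = M $ 3 $ 3"
        "m33 = (M $ 1 $ 1 - \<i> * M $ 1 $ 2 + \<i> * M $ 2 $ 1 + M $ 2 $ 2) / 2"
        "m12 = (M $ 1 $ 3 - \<i> * M $ 2 $ 3) / r2"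
        "m21 = (M $ 3 $ 1 + \<i> * M $ 3 $ 2) / r2"
        "m13 = (M $ 1 $ 1 - \<i> * M $ 1 $ 2 - \<i> * M $ 2 $ 1 - M $ 2 $ 2) / 2"
        "m31 = (M $ 1 $ 1 + \<i> * M $ 1 $ 2 + \<i> * M $ 2 $ 1 - M $ 2 $ 2) / 2"
        "m23 = (M $ 3 $ 1 - \<i> * M $ 3 $ 2) / r2"
        "m32 = (M $ 1 $ 3 + \<i> * M $ 2 $ 3) / r2"
      \<comment> \<open>Conjugation swaps the first and third columns of \<open>Q\<close>, so a
        conjugate of an element of II has rows \<open>(-2x, 0, 0)\<close>, \<open>(z, x, y)\<close>,
        \<open>(w, y, x)\<close> in that basis. Comparing entries gives the coefficients:
        \<open>m22 - m33\<close> is three times \<open>a\<close>, \<open>m22 - m11\<close> is three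
        times \<open>x\<close>, and \<open>m23\<close>, \<open>m21\<close> are corrected by the
        \<open>y\<close> and \<open>b\<close> already found.\<close>
      have "M = II_elt ((m22 - m33) / 3) m12 (m23 - m32) m13
          + sigma_conj (II_elt (cnj ((m22 - m11) / 3)) (cnj m32) (cnj (m21 - m12)) (cnj m31))"
        by (simp add: mat3_eq_iff II_elt_def m M33 field_simps)
      then show "M \<in> ?S"
        unfolding subalg_II_eq by blast
    qed
  qed
  show "subalg_II \<inter> sigma_conj ` subalg_II = {0}"
  proof
    show "{0} \<subseteq> subalg_II \<inter> sigma_conj ` subalg_II"
    proof -
      have "II_elt 0 0 0 0 = 0" "sigma_conj 0 = 0"
        by (simp_all add: mat3_eq_iff II_elt_def)
      then have "0 \<in> subalg_II"
        unfolding subalg_II_eq by force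
      with \<open>sigma_conj 0 = 0\<close> show ?thesis
        by force
    qed
    show "subalg_II \<inter> sigma_conj ` subalg_II \<subseteq> {0}"
    proof clarify
      fix A B assume "sigma_conj B \<in> subalg_II" "B \<in> subalg_II"
      then obtain a b c d a' b' c' d' where eq: "sigma_conj B = II_elt a b c d" "B = II_elt a' b' c' d'"
        unfolding subalg_II_eq by blast
      define M where "M = sigma_conj B"
      have I: "M = II_elt a b c d" and \<sigma>: "M = sigma_conj (II_elt a' b' c' d')"
        using eq by (simp_all add: M_def)
      \<comment> \<open>Each coordinate is read off from \<open>M\<close> as an element of II, by a
        functional that vanishes on conjugates of II: here \<open>m13\<close>, then
        \<open>m22 - m33\<close> and a multiple of \<open>m12\<close>.\<close>
      have "d = (M $ 1 $ 1 - \<i> * M $ 1 $ 2 - \<i> * M $ 2 $ 1 - M $ 2 $ 2) / 2"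
        by (simp add: I II_elt_def field_simps)
      also have "\<dots> = 0"
        by (simp add: \<sigma> II_elt_def field_simps)
      finally have d: "d = 0" .
      have "3 * a = M $ 3 $ 3 - (M $ 1 $ 1 - \<i> * M $ 1 $ 2 + \<i> * M $ 2 $ 1 + M $ 2 $ 2) / 2"
        by (simp add: I II_elt_def field_simps)
      also have "\<dots> = 0"
        by (simp add: \<sigma> II_elt_def field_simps)
      finally have a: "a = 0" by simp
      have "2 * b / r2 = M $ 1 $ 3 - \<i> * M $ 2 $ 3"
        by (simp add: I II_elt_def field_simps)
      also have "\<dots> = 0"
        by (simp add: \<sigma> II_elt_def field_simps)
      finally have b: "b = 0" by simp
      \<comment> \<open>For \<open>c\<close> both descriptions are needed twice: \<open>m23\<close>
        equals \<open>m32\<close> on the conjugate of II, and \<open>m32\<close> vanishes on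
        II.\<close>
      have "2 * c / r2 = M $ 3 $ 1 - \<i> * M $ 3 $ 2"
        by (simp add: I II_elt_def field_simps)
      also have "\<dots> = M $ 1 $ 3 + \<i> * M $ 2 $ 3"
        by (simp add: \<sigma> II_elt_def field_simps)
      also have "\<dots> = 0"
        by (simp add: I II_elt_def field_simps)
      finally have "c = 0" by simp
      with a b d have "a = 0 \<and> b = 0 \<and> c = 0 \<and> d = 0"
        by simp
      then show "sigma_conj B = 0"
        using eq by (simp add: mat3_eq_iff II_elt_def)
    qed
  qed
qed

section \<open>Explicit matrices for the root vectors\<close>

text \<open>\<open>matrix_inv\<close> is a choice among two-sided inverses; over a field a right
  inverse of a square matrix is two-sided, and then it is unique.\<close>

lemma matrix_inv_eqI:
  fixes A :: "'a::field^'n^'n"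
  assumes "A ** B = mat 1"
  shows "matrix_inv A = B"
proof -
  have "A ** matrix_inv A = mat 1 \<and> matrix_inv A ** A = mat 1"
    unfolding matrix_inv_def
    by (rule someI[where x = B]) (use assms matrix_left_right_inverse in blast)
  then show ?thesis
    by (metis assms matrix_mul_assoc matrix_mul_lid matrix_mul_rid)
qed

lemma matrix_inv_Q_mat: "matrix_inv Q_mat = transpose (sigma_conj Q_mat)"
  by (rule matrix_inv_eqI) (simp add: mat3_eq_iff matrix_mult_nth3 transpose_def Q_mat_def mat_def field_simps)

lemma Q_conj_nth:
  "Q_conj A $ i $ j = (\<Sum>k\<in>UNIV. \<Sum>l\<in>UNIV. Q_mat $ i $ k * A $ k $ l * cnj (Q_mat $ j $ l))"
  unfolding Q_conj_def matrix_inv_Q_mat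
  by (simp add: matrix_mult_nth3 sum_3 transpose_def algebra_simps)

text \<open>As \<open>Q\<close> is unitary, conjugating \<open>E_mat j k\<close> gives column
  \<open>j\<close> of \<open>Q\<close> times the conjugate transpose of column
  \<open>k\<close>.\<close>

lemma root_vectors:
  "H_alpha = (1/2) *\<^sub>M vector [vector [1, -\<i>, 0], vector [\<i>, 1, 0], vector [0, 0, -2]]"
  "H_beta = (1/2) *\<^sub>M vector [vector [-1, -\<i>, 0], vector [\<i>, -1, 0], vector [0, 0, 2]]"
  "e_alpha = (1/r2) *\<^sub>M vector [vector [0, 0, 1], vector [0, 0, \<i>], vector [0, 0, 0]]"
  "e_minus_alpha = (1/r2) *\<^sub>M vector [vector [0, 0, 0], vector [0, 0, 0], vector [1, -\<i>, 0]]"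
  "e_beta = (1/r2) *\<^sub>M vector [vector [0, 0, 0], vector [0, 0, 0], vector [1, \<i>, 0]]"
  "e_gamma = (1/2) *\<^sub>M vector [vector [1, \<i>, 0], vector [\<i>, -1, 0], vector [0, 0, 0]]"
  by (simp_all add: mat3_eq_iff H_alpha_def H_beta_def e_alpha_def e_minus_alpha_def e_beta_def
      e_gamma_def Q_conj_nth sum_3 Q_mat_def E_mat_def transpose_def field_simps)

section \<open>The automorphism carrying II onto III\<close>

definition K_mat :: cmat3
  where "K_mat = vector [vector [1, 0, r2], vector [0, 1, 0], vector [- r2, 0, 0]]"

definition K_inv :: cmat3
  where "K_inv = (1/2) *\<^sub>M vector [vector [0, 0, - r2], vector [0, 2, 0], vector [r2, 0, 1]]"

lemma K_mat_K_inv: "K_mat ** K_inv = mat 1"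
  by (simp add: mat3_eq_iff matrix_mult_nth3 K_mat_def K_inv_def mat_def)

lemma outer_aut_K_real: "sigma_conj (outer_aut K_mat K_inv A) = outer_aut K_mat K_inv (sigma_conj A)"
proof -
  have "sigma_conj K_mat = K_mat" "sigma_conj K_inv = K_inv"
    by (simp_all add: mat3_eq_iff K_mat_def K_inv_def)
  then show ?thesis
    by (simp add: outer_aut_def sigma_conj_simps)
qed

text \<open>In the basis of columns of \<open>Q\<close> the map sends \<open>m\<close> to minus
  \<open>G\<close> times the transpose of \<open>m\<close> times the inverse of \<open>G\<close>.
  Treating a general combination at once makes the equality of spans immediate.\<close>

lemma outer_aut_II_elt:
  "outer_aut K_mat K_inv (II_elt a b c d) = a *\<^sub>M U_mat + b *\<^sub>M X_mat + c *\<^sub>M Y_mat + d *\<^sub>M Z_mat"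
  by (simp add: mat3_eq_iff outer_aut_def matrix_mult_nth3 transpose_def K_mat_def K_inv_def
      II_elt_def U_mat_def X_mat_def Y_mat_def Z_mat_def root_vectors field_simps)

lemma outer_aut_II: "outer_aut K_mat K_inv ` subalg_II = subalg_III"
  unfolding subalg_II_eq subalg_III_def span_4 by (force simp flip: outer_aut_II_elt)

theorem proposition3p1:
  shows "invariant_complex_subalgebra subalg_II \<and>
         invariant_complex_subalgebra subalg_III \<and>
         equivalent_subalgebras subalg_II subalg_III"
proof -
  note aut = outer_aut_lie_automorphism[OF K_mat_K_inv]
  have "invariant_complex_subalgebra subalg_III"
    using invariant_complex_subalgebra_image[OF invariant_II aut outer_aut_K_real]
    by (simp add: outer_aut_II)
  moreover have "equivalent_subalgebras subalg_II subalg_III"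
    unfolding equivalent_subalgebras_def
    using aut outer_aut_K_real outer_aut_II by blast
  ultimately show ?thesis
    using invariant_II by blast
qed

end
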